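(* Let $\mathcal X^\star\in\mathbb R^{d_1\times\cdots\times d_N}$ be a tensor in tensor train format with ranks $\mathbf r=(r_1,\dots,r_{N-1})$, let $\overline r=\max_i r_i$, let $\mathbf s\in\mathbb R^m$ be an outlier vector with fraction of nonzero entries $p_s=\|\mathbf s\|_0/m$, and let $\mathbf y=\mathcal A(\mathcal X^\star)+\mathbf s$, where $\mathcal A(\mathcal X)=(\langle\mathcal A_k,\mathcal X\rangle)_{k=1}^m$ is (a realization of) a Gaussian measurement operator, whose $\{\mathcal A_k\}_{k=1}^m$ have i.i.d. standard Gaussian entries. Suppose that $\mathcal A$ satisfies the $\ell_1/\ell_2$-RIP and the sharpness property with constant $\delta_{2\overline r}$ (as defined in the context). Let $f(\mathcal X)=\frac1m\|\mathcal A(\mathcal X)-\mathbf y\|_1$ and let $\partial f(\mathcal X)=\frac1m\sum_{k=1}^m\operatorname{sign}(\langle\mathcal A_k,\mathcal X\rangle-y_k)\,\mathcal A_k$. Then $f$ satisfies the robust regularity condition $$\langle\mathcal X-\mathcal X^\star,\ \partial f(\mathcal X)\rangle\ \ge\ \left((1-2p_s)\sqrt{2/\pi}-\delta_{2\overline r}\right)\|\mathcal X-\mathcal X^\star\|_F$$ for every tensor $\mathcal X\in\mathbb R^{d_1\times\cdots\times d_N}$ in tensor train format with ranks $\mathbf r$.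
   Context: A tensor $\mathcal X\in\mathbb R^{d_1\times\cdots\times d_N}$ is in tensor train (TT) format with ranks $\mathbf r=(r_1,\dots,r_{N-1})$ if there are order-3 tensors $\mathbf X_i\in\mathbb R^{r_{i-1}\times d_i\times r_i}$, $i=1,\dots,N$, $r_0=r_N=1$, with $\mathcal X(s_1,\dots,s_N)=\mathbf X_1(s_1)\cdots\mathbf X_N(s_N)$, where $\mathbf X_i(s_i)=\mathbf X_i(:,s_i,:)$. $\langle\cdot,\cdot\rangle$ is the entrywise inner product, $\|\cdot\|_F$ the induced norm. $\operatorname{sign}(x)=-1,0,1$ for $x<0$, $x=0$, $x>0$ respectively. $\ell_1/\ell_2$-RIP with constant $\delta_{2\overline r}\in(0,\sqrt{2/\pi})$: $(\sqrt{2/\pi}-\delta_{2\overline r})\|\mathcal X\|_F\le\frac1m\|\mathcal A(\mathcal X)\|_1\le(\sqrt{2/\pi}+\delta_{2\overline r})\|\mathcal X\|_F$ for all $\mathcal X$ in TT format with all ranks at most $2\overline r$. Sharpness with constant $\delta_{2\overline r}$: $\frac1m\|\mathcal A(\mathcal X-\mathcal X^\star)-\mathbf s\|_1-\frac1m\|\mathbf s\|_1\ge((1-2p_s)\sqrt{2/\pi}-\delta_{2\overline r})\|\mathcal X-\mathcal X^\star\|_F$ for all $\mathcal X$ in TT format with ranks $\mathbf r$. *)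

theory Defs
  imports "HOL-Probability.Probability" "Jordan_Normal_Form.Matrix"
begin

text \<open>Order and dimensions are term-level parameters: an \<open>N\<close>-th order tensor of size
  \<open>d 1 \<times> \<dots> \<times> d N\<close> is a function on multi-indices \<open>t\<close> with \<open>t i \<in> {1..d i}\<close> for
  \<open>i \<in> {1..N}\<close>. Only the values on \<open>tensor_idx N d\<close> are meaningful; everything below
  depends on those values alone.\<close>

type_synonym tensor = "(nat \<Rightarrow> nat) \<Rightarrow> real"

definition tensor_idx :: "nat \<Rightarrow> (nat \<Rightarrow> nat) \<Rightarrow> (nat \<Rightarrow> nat) set" where
  "tensor_idx N d = (\<Pi>\<^sub>E i\<in>{1..N}. {1..d i})"

definition tensor_diff :: "tensor \<Rightarrow> tensor \<Rightarrow> tensor" where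
  "tensor_diff X Y = (\<lambda>t. X t - Y t)"

definition tensor_inner :: "nat \<Rightarrow> (nat \<Rightarrow> nat) \<Rightarrow> tensor \<Rightarrow> tensor \<Rightarrow> real" where
  "tensor_inner N d X Y = (\<Sum>t\<in>tensor_idx N d. X t * Y t)"

definition frob_norm :: "nat \<Rightarrow> (nat \<Rightarrow> nat) \<Rightarrow> tensor \<Rightarrow> real" where
  "frob_norm N d X = sqrt (tensor_inner N d X X)"

text \<open>A rank vector is \<open>r 1, \<dots>, r (N - 1)\<close>, extended by the convention \<open>r 0 = r N = 1\<close>.\<close>

definition tt_ranks :: "nat \<Rightarrow> (nat \<Rightarrow> nat) \<Rightarrow> bool" where
  "tt_ranks N r \<longleftrightarrow> r 0 = 1 \<and> r N = 1 \<and> (\<forall>i\<in>{1..<N}. 1 \<le> r i)"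

text \<open>\<open>G i j\<close> is the slice \<open>X\<^sub>i(:, j, :)\<close> of the \<open>i\<close>-th core. The product
  \<open>X\<^sub>1(t 1) \<cdots> X\<^sub>N(t N)\<close> is a \<open>1 \<times> 1\<close> matrix, identified with its single entry
  (matrix indices of the library start at 0).\<close>

definition tt_format :: "nat \<Rightarrow> (nat \<Rightarrow> nat) \<Rightarrow> (nat \<Rightarrow> nat) \<Rightarrow> tensor \<Rightarrow> bool" where
  "tt_format N d r X \<longleftrightarrow>
     tt_ranks N r \<and>
     (\<exists>G :: nat \<Rightarrow> nat \<Rightarrow> real mat.
        (\<forall>i\<in>{1..N}. \<forall>j\<in>{1..d i}. G i j \<in> carrier_mat (r (i - 1)) (r i)) \<and>
        (\<forall>t\<in>tensor_idx N d.
           X t = foldr (*) (map (\<lambda>i. G i (t i)) [1..<Suc N]) (1\<^sub>m 1) $$ (0, 0)))"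

text \<open>Vectors in \<open>\<real>\<^sup>m\<close> are functions on \<open>{1..m}\<close>.\<close>

definition l1_norm :: "nat \<Rightarrow> (nat \<Rightarrow> real) \<Rightarrow> real" where
  "l1_norm m v = (\<Sum>k\<in>{1..m}. \<bar>v k\<bar>)"

definition l0_norm :: "nat \<Rightarrow> (nat \<Rightarrow> real) \<Rightarrow> nat" where
  "l0_norm m v = card {k\<in>{1..m}. v k \<noteq> 0}"

definition meas_op ::
    "nat \<Rightarrow> (nat \<Rightarrow> nat) \<Rightarrow> (nat \<Rightarrow> tensor) \<Rightarrow> tensor \<Rightarrow> nat \<Rightarrow> real" where
  "meas_op N d A X = (\<lambda>k. tensor_inner N d (A k) X)"

text \<open>\<open>G k t\<close> is the random variable giving entry \<open>t\<close> of the \<open>k\<close>-th measurement tensor;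
  all these entries are jointly independent.\<close>

definition gaussian_meas ::
    "'w measure \<Rightarrow> nat \<Rightarrow> (nat \<Rightarrow> nat) \<Rightarrow> nat \<Rightarrow> (nat \<Rightarrow> (nat \<Rightarrow> nat) \<Rightarrow> 'w \<Rightarrow> real) \<Rightarrow> bool"
  where
  "gaussian_meas P N d m G \<longleftrightarrow>
     prob_space P \<and>
     prob_space.indep_vars P (\<lambda>_. borel) (\<lambda>(k, t). G k t) ({1..m} \<times> tensor_idx N d) \<and>
     (\<forall>k\<in>{1..m}. \<forall>t\<in>tensor_idx N d. distributed P lborel (G k t) std_normal_density)"

definition l1_l2_rip ::
    "nat \<Rightarrow> (nat \<Rightarrow> nat) \<Rightarrow> nat \<Rightarrow> (nat \<Rightarrow> tensor) \<Rightarrow> nat \<Rightarrow> real \<Rightarrow> bool" where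
  "l1_l2_rip N d m A R \<delta> \<longleftrightarrow>
     0 < \<delta> \<and> \<delta> < sqrt (2 / pi) \<and>
     (\<forall>X r. tt_format N d r X \<and> (\<forall>i\<in>{1..<N}. r i \<le> R) \<longrightarrow>
        (sqrt (2 / pi) - \<delta>) * frob_norm N d X \<le> 1 / real m * l1_norm m (meas_op N d A X) \<and>
        1 / real m * l1_norm m (meas_op N d A X) \<le> (sqrt (2 / pi) + \<delta>) * frob_norm N d X)"

definition sharpness ::
    "nat \<Rightarrow> (nat \<Rightarrow> nat) \<Rightarrow> nat \<Rightarrow> (nat \<Rightarrow> tensor) \<Rightarrow> (nat \<Rightarrow> nat) \<Rightarrow> tensor \<Rightarrow>
     (nat \<Rightarrow> real) \<Rightarrow> real \<Rightarrow> real \<Rightarrow> bool" where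
  "sharpness N d m A r Xstar s p \<delta> \<longleftrightarrow>
     (\<forall>X. tt_format N d r X \<longrightarrow>
        1 / real m * l1_norm m (\<lambda>k. meas_op N d A (tensor_diff X Xstar) k - s k)
          - 1 / real m * l1_norm m s
        \<ge> ((1 - 2 * p) * sqrt (2 / pi) - \<delta>) * frob_norm N d (tensor_diff X Xstar))"

definition l1_loss ::
    "nat \<Rightarrow> (nat \<Rightarrow> nat) \<Rightarrow> nat \<Rightarrow> (nat \<Rightarrow> tensor) \<Rightarrow> (nat \<Rightarrow> real) \<Rightarrow> tensor \<Rightarrow> real" where
  "l1_loss N d m A y X = 1 / real m * l1_norm m (\<lambda>k. meas_op N d A X k - y k)"

definition l1_loss_subgrad ::
    "nat \<Rightarrow> (nat \<Rightarrow> nat) \<Rightarrow> nat \<Rightarrow> (nat \<Rightarrow> tensor) \<Rightarrow> (nat \<Rightarrow> real) \<Rightarrow> tensor \<Rightarrow> tensor" where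
  "l1_loss_subgrad N d m A y X =
     (\<lambda>t. 1 / real m * (\<Sum>k\<in>{1..m}. sgn (tensor_inner N d (A k) X - y k) * A k t))"

lemma tensor_inner_l1_loss_subgrad:
  "tensor_inner N d Z (l1_loss_subgrad N d m A y X) =
     1 / real m * (\<Sum>k\<in>{1..m}. sgn (tensor_inner N d (A k) X - y k) * tensor_inner N d (A k) Z)"
proof -
  have "tensor_inner N d Z (l1_loss_subgrad N d m A y X) =
      (\<Sum>t\<in>tensor_idx N d. \<Sum>k\<in>{1..m}.
         1 / real m * (sgn (tensor_inner N d (A k) X - y k) * (A k t * Z t)))"
    unfolding tensor_inner_def l1_loss_subgrad_def sum_distrib_left sum_distrib_right
    by (intro sum.cong refl) (simp add: ac_simps)
  also have "\<dots> = (\<Sum>k\<in>{1..m}. \<Sum>t\<in>tensor_idx N d.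
         1 / real m * (sgn (tensor_inner N d (A k) X - y k) * (A k t * Z t)))"
    by (rule sum.swap)
  finally show ?thesis
    by (simp only: tensor_inner_def sum_distrib_left)
qed

text \<open>\<open>l1_loss_subgrad\<close> selects a subgradient of the convex function \<open>l1_loss\<close>.\<close>

lemma l1_loss_subgrad:
  "l1_loss N d m A y Z \<ge>
     l1_loss N d m A y X + tensor_inner N d (tensor_diff Z X) (l1_loss_subgrad N d m A y X)"
proof -
  have diff: "tensor_inner N d B (tensor_diff Z X) = tensor_inner N d B Z - tensor_inner N d B X" for B
    by (simp add: tensor_inner_def tensor_diff_def algebra_simps sum_subtractf)
  have abs: "\<bar>u\<bar> + sgn u * (v - u) \<le> \<bar>v\<bar>" for u v :: real
    by (auto simp: sgn_if)
  have "(\<Sum>k\<in>{1..m}. \<bar>tensor_inner N d (A k) X - y k\<bar>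
          + sgn (tensor_inner N d (A k) X - y k) * tensor_inner N d (A k) (tensor_diff Z X))
        \<le> (\<Sum>k\<in>{1..m}. \<bar>tensor_inner N d (A k) Z - y k\<bar>)"
  proof (rule sum_mono)
    fix k
    show "\<bar>tensor_inner N d (A k) X - y k\<bar>
          + sgn (tensor_inner N d (A k) X - y k) * tensor_inner N d (A k) (tensor_diff Z X)
        \<le> \<bar>tensor_inner N d (A k) Z - y k\<bar>"
      using abs[of "tensor_inner N d (A k) X - y k" "tensor_inner N d (A k) Z - y k"]
      by (simp add: diff)
  qed
  from mult_left_mono[OF this, of "1 / real m"] show ?thesis
    unfolding tensor_inner_l1_loss_subgrad
    by (simp add: l1_loss_def l1_norm_def meas_op_def sum.distrib distrib_left add_divide_distrib)
qed

end

theory Submission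
  imports Defs
begin

text \<open>The loss f is convex, and \<open>l1_loss_subgrad\<close> supplies its subgradient
  inequality based at X. Evaluated at the ground truth \<open>Xstar\<close>, it gives <X - Xstar,
  subgradient at X> \<ge> f(X) - f(Xstar). Since y is the measurement of \<open>Xstar\<close> plus
  s, linearity of the measurements turns this loss gap into exactly the quantity that sharpness
  bounds below, so regularity follows from sharpness by convexity.\<close>

lemma tensor_inner_diff_right:
  "tensor_inner N d B (tensor_diff Y X) = tensor_inner N d B Y - tensor_inner N d B X"
  by (simp add: tensor_inner_def tensor_diff_def right_diff_distrib sum_subtractf)

lemma tensor_inner_diff_left_swap:
  "tensor_inner N d (tensor_diff Y X) B = - tensor_inner N d (tensor_diff X Y) B"
  by (simp add: tensor_inner_def tensor_diff_def left_diff_distrib sum_subtractf)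

theorem lemma3:
  fixes P :: "'w measure"
    and G :: "nat \<Rightarrow> (nat \<Rightarrow> nat) \<Rightarrow> 'w \<Rightarrow> real" and \<omega> :: 'w
    and N m rbar :: nat and d r :: "nat \<Rightarrow> nat"
    and A :: "nat \<Rightarrow> tensor" and Xstar :: tensor
    and s y :: "nat \<Rightarrow> real" and p_s \<delta> :: real
  assumes "1 \<le> N" and "\<forall>i\<in>{1..N}. 1 \<le> d i" and "1 \<le> m"
    and "tt_format N d r Xstar"
    and "rbar = Max (r ` {1..<N})"
    and "p_s = real (l0_norm m s) / real m"
    and "gaussian_meas P N d m G" and "\<omega> \<in> space P"
    and "A = (\<lambda>k t. G k t \<omega>)"
    and "\<forall>k\<in>{1..m}. y k = meas_op N d A Xstar k + s k"
    and "l1_l2_rip N d m A (2 * rbar) \<delta>"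
    and "sharpness N d m A r Xstar s p_s \<delta>"
  shows "\<forall>X. tt_format N d r X \<longrightarrow>
    tensor_inner N d (tensor_diff X Xstar) (l1_loss_subgrad N d m A y X)
      \<ge> ((1 - 2 * p_s) * sqrt (2 / pi) - \<delta>) * frob_norm N d (tensor_diff X Xstar)"
proof (intro allI impI)
  fix X
  assume X: "tt_format N d r X"
  have y: "y k = tensor_inner N d (A k) Xstar + s k" if "k \<in> {1..m}" for k
    using assms(10) that by (simp add: meas_op_def)
  have loss_X: "l1_loss N d m A y X =
      1 / real m * l1_norm m (\<lambda>k. meas_op N d A (tensor_diff X Xstar) k - s k)"
    unfolding l1_loss_def l1_norm_def meas_op_def tensor_inner_diff_right
    \<comment> \<open>\<open>sum.cong\<close> supplies the range condition on k under which
      \<open>y\<close> may be rewritten; both residuals then regroup to the same term.\<close>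
    by (intro arg_cong2[of _ _ _ _ "(*)"] sum.cong refl) (simp only: y diff_diff_eq)
  have loss_Xstar: "l1_loss N d m A y Xstar = 1 / real m * l1_norm m s"
    unfolding l1_loss_def l1_norm_def meas_op_def
    \<comment> \<open>The residual at the ground truth is -s k; the absolute value removes the
      sign.\<close>
    by (intro arg_cong2[of _ _ _ _ "(*)"] sum.cong refl) (simp only: y)
  have "((1 - 2 * p_s) * sqrt (2 / pi) - \<delta>) * frob_norm N d (tensor_diff X Xstar)
      \<le> l1_loss N d m A y X - l1_loss N d m A y Xstar"
    using assms(12) X unfolding sharpness_def loss_X loss_Xstar by blast
  also have "\<dots> \<le> tensor_inner N d (tensor_diff X Xstar) (l1_loss_subgrad N d m A y X)"
    \<comment> \<open>Base point X and test point \<open>Xstar\<close> give the direction Xstar - X;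
      reversing it moves the inner product to the other side with the sign needed.\<close>
    using l1_loss_subgrad[of N d m A y X Xstar]
    by (simp add: tensor_inner_diff_left_swap[of N d Xstar X])
  finally show "((1 - 2 * p_s) * sqrt (2 / pi) - \<delta>) * frob_norm N d (tensor_diff X Xstar)
      \<le> tensor_inner N d (tensor_diff X Xstar) (l1_loss_subgrad N d m A y X)" .
qed

end
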